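(* For integers $1 \leq i \leq n$, $$a_{n,i} = s_o(n,i) - s_e(n,i) = [q^n]\left((q;q)_{\infty}\cdot \frac{q^i}{1-q^i}\right).$$ Moreover, for every $n \geq 1$ the lower triangular matrix $A_n := (a_{i,j})_{1 \leq i,j \leq n}$ is invertible, and the entries $a_{n,i}^{-1}$ ($1 \leq i \leq n$) of its inverse (row index $n$, column index $i$) satisfy $$a_{n,i}^{-1} = \sum_{d|n} p(d-i)\, \mu\left(\frac{n}{d}\right).$$
   Context: For $1 \leq i \leq n$ define $a_{n,i} := \sum (-1)^k$, where the sum is over all pairs $(k,s)$ of integers $k,s \geq 0$ such that $(s+1)i + \frac{k(3k+1)}{2} = n$ or $(s+1)i + \frac{k(3k-1)}{2} = n$ (each pair is counted once); set $a_{n,i} := 0$ for $i>n$. The matrices $A_n$ are lower triangular with ones on the diagonal, and $A_n^{-1}$ is the leading block of $A_{n+1}^{-1}$, so the inverse entries $a^{-1}_{n,i}$ do not depend on the size of the matrix. $s_o(n,k)$ (respectively $s_e(n,k)$) is the total number of parts equal to $k$ in all partitions of $n$ into an odd (respectively even) number of distinct parts. $(q;q)_\infty := \prod_{m\geq 1}(1-q^m)$, $[q^n]F(q)$ is the coefficient of $q^n$ in $F(q)$, $\mu$ is the Möbius function, and $p(n) = [q^n](q;q)_\infty^{-1}$ is the partition function, with $p(0)=1$ and $p(n)=0$ for $n<0$. *)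

theory Defs
  imports
    "HOL-Library.Multiset"
    "HOL-Computational_Algebra.Formal_Power_Series"
    "HOL-Computational_Algebra.Squarefree"
    "HOL-Analysis.Infinite_Products"
    "Jordan_Normal_Form.Matrix"
begin

(* The condition is a disjunction inside one set of pairs, so for k = 0, where the two pentagonal
   expressions coincide, a pair is still counted only once. Both quotients by 2 are exact, and the
   truncated subtraction is harmless because of the factor k. *)
definition a_entry :: "nat \<Rightarrow> nat \<Rightarrow> int" where
  "a_entry n i = (if 1 \<le> i \<and> i \<le> n then
     (\<Sum>(k, s) \<in> {(k, s).
          (s + 1) * i + (k * (3 * k + 1)) div 2 = n \<or>
          (s + 1) * i + (k * (3 * k - 1)) div 2 = n}. (- 1) ^ k)
     else 0)"

definition distinct_partitions :: "nat \<Rightarrow> nat multiset set" where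
  "distinct_partitions n = {P. 0 \<notin># P \<and> (\<forall>x. count P x \<le> 1) \<and> sum_mset P = n}"

definition s_o :: "nat \<Rightarrow> nat \<Rightarrow> nat" where
  "s_o n k = (\<Sum>P \<in> {P \<in> distinct_partitions n. odd (size P)}. count P k)"

definition s_e :: "nat \<Rightarrow> nat \<Rightarrow> nat" where
  "s_e n k = (\<Sum>P \<in> {P \<in> distinct_partitions n. even (size P)}. count P k)"

(* The product over m >= 1 of 1 - q^m, convergent in the metric of formal power series; the index
   is shifted because prodinf starts at 0. *)
definition euler_product :: "rat fps" where
  "euler_product = prodinf (\<lambda>m. 1 - fps_X ^ (m + 1))"

definition partition_p :: "int \<Rightarrow> rat" where
  "partition_p n = (if n < 0 then 0 else fps_nth (inverse euler_product) (nat n))"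

definition moebius_mu :: "nat \<Rightarrow> int" where
  "moebius_mu n = (if squarefree n then (- 1) ^ card (prime_factors n) else 0)"

(* Matrix indices start at 0, hence the shift. *)
definition A_mat :: "nat \<Rightarrow> rat mat" where
  "A_mat n = mat n n (\<lambda>(r, c). of_int (a_entry (r + 1) (c + 1)))"

end

theory Submission
  imports Defs "Jordan_Normal_Form.Determinant"
begin

text \<open>The pentagonal number theorem turns the pair sum \<open>a\<^sub>n\<^sub>,\<^sub>i\<close> into the \<open>n\<close>-th coefficient of
  \<open>(q;q)\<^sub>\<infinity> q\<^sup>i / (1 - q\<^sup>i)\<close>. Cancelling the factor \<open>1 - q\<^sup>i\<close> leaves \<open>q\<^sup>i\<close> times the product over
  \<open>m \<noteq> i\<close>, whose expansion is the signed count of the partitions into distinct parts containing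
  \<open>i\<close>. For the inverse matrix, convolving a column of \<open>A\<close> with the partition numbers cancels
  \<open>(q;q)\<^sub>\<infinity>\<close> and leaves the indicator of \<open>i dvd d\<close>, which Moebius inversion over the divisors of
  \<open>n\<close> turns into the Kronecker delta.\<close>

section \<open>The Euler product and the pentagonal number theorem\<close>

definition euler_partial :: "nat \<Rightarrow> rat fps" where
  "euler_partial n = (\<Prod>m\<in>{1..n}. 1 - fps_X ^ m)"

lemma euler_partial_Suc:
  "euler_partial (Suc n) = euler_partial n - fps_X ^ Suc n * euler_partial n"
  by (simp add: euler_partial_def algebra_simps)

text \<open>A further factor 1 - X^(n+1) changes only coefficients of index greater than n, so
  coefficient m is final once the factors up to m are present.\<close>

lemma euler_partial_nth_eq:
  assumes "m \<le> n"
  shows "fps_nth (euler_partial n) m = fps_nth (euler_partial m) m"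
  using assms
proof (induction n rule: dec_induct)
  case (step n)
  have "fps_nth (fps_X ^ Suc n * euler_partial n) m = 0"
    using step.hyps by (subst fps_X_power_mult_nth) simp
  then show ?case
    using step.IH by (simp only: euler_partial_Suc fps_sub_nth)
qed simp

lemma euler_product_eq: "euler_product = Abs_fps (\<lambda>m. fps_nth (euler_partial m) m)"
proof -
  let ?E = "Abs_fps (\<lambda>m. fps_nth (euler_partial m) m)"
  have "euler_partial (Suc n) = (\<Prod>i\<le>n. 1 - fps_X ^ (i + 1))" for n
    unfolding euler_partial_def
    by (rule prod.reindex_bij_witness[of _ Suc "\<lambda>m. m - 1"]) auto
  moreover have "(\<lambda>n. euler_partial (Suc n)) \<longlonglongrightarrow> ?E"
  proof (rule tendsto_fpsI)
    fix m
    show "eventually (\<lambda>n. fps_nth (euler_partial (Suc n)) m = fps_nth ?E m) sequentially"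
      using eventually_ge_at_top[of m]
      by eventually_elim (simp add: euler_partial_nth_eq[of m "Suc _"])
  qed
  \<comment> \<open>\<open>raw_has_prod\<close> demands a nonzero limit; the constant coefficient
    witnesses this.\<close>
  moreover have "fps_nth ?E 0 = 1"
    by (simp add: euler_partial_def)
  then have "?E \<noteq> 0"
    by (metis fps_zero_nth zero_neq_one)
  ultimately have "(\<lambda>m. 1 - fps_X ^ (m + 1)) has_prod ?E"
    by (simp add: has_prod_def raw_has_prod_def)
  then show ?thesis
    unfolding euler_product_def by (rule has_prod_unique[symmetric])
qed

lemma euler_product_nth:
  "m \<le> n \<Longrightarrow> fps_nth euler_product m = fps_nth (euler_partial n) m"
  using euler_partial_nth_eq[of m n] by (simp add: euler_product_eq)

lemma euler_product_nth_0: "fps_nth euler_product 0 = 1"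
  by (simp add: euler_product_eq euler_partial_def)

section \<open>Shanks' finite sums\<close>

definition triangular :: "nat \<Rightarrow> nat" where
  "triangular s = s * (s + 1) div 2"

lemma triangular_0 [simp]: "triangular 0 = 0"
  and triangular_Suc: "triangular (Suc s) = triangular s + s + 1"
  by (simp_all add: triangular_def)

text \<open>For s \<le> n the product is (q;q)_n / (q;q)_s, written without division so that q may
  lie in any commutative ring.\<close>

definition shanks_term :: "'a::comm_ring_1 \<Rightarrow> nat \<Rightarrow> nat \<Rightarrow> 'a" where
  "shanks_term q n s = (-1) ^ s * (\<Prod>m\<in>{s<..n}. 1 - q ^ m) * q ^ (s * n + triangular s)"

text \<open>The changes caused by raising n collapse to one boundary term. At j = n its product is
  empty and a single power of q remains, which becomes one of the two new pentagonal terms.\<close>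

lemma shanks_telescope:
  fixes q :: "'a::comm_ring_1"
  assumes "j \<le> n"
  shows "(\<Sum>s\<le>j. shanks_term q (Suc n) s - shanks_term q n s) =
    (-1) ^ Suc j * (\<Prod>m\<in>{j<..n}. 1 - q ^ m) * q ^ (Suc j * Suc n + triangular j)"
  using assms
proof (induction j)
  case 0
  have "{0<..Suc n} = insert (Suc n) {0<..n}" by auto
  then show ?case
    by (simp add: shanks_term_def algebra_simps)
next
  case (Suc j)
  \<comment> \<open>In these abbreviations the induction step reads (1 - v) u + (1 - w) u v - u = -
    u v w, multiplied by R and a sign.\<close>
  define R where "R = (\<Prod>m\<in>{Suc j<..n}. 1 - q ^ m)"
  define u where "u = q ^ (Suc j * Suc n + triangular j)"
  define v where "v = q ^ Suc j"
  define w where "w = q ^ Suc n"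
  have "{j<..n} = insert (Suc j) {Suc j<..n}" using Suc.prems by auto
  then have 1: "(\<Prod>m\<in>{j<..n}. 1 - q ^ m) = (1 - v) * R"
    by (simp add: R_def v_def)
  have "{Suc j<..Suc n} = insert (Suc n) {Suc j<..n}" using Suc.prems by auto
  then have 2: "(\<Prod>m\<in>{Suc j<..Suc n}. 1 - q ^ m) = (1 - w) * R"
    by (simp add: R_def w_def)
  have 3: "q ^ (Suc j * Suc n + triangular (Suc j)) = u * v"
    unfolding u_def v_def power_add[symmetric] triangular_Suc by (simp only: add_Suc_right add_ac Suc_eq_plus1)
  have 4: "q ^ (Suc j * n + triangular (Suc j)) = u"
    by (simp add: u_def triangular_Suc algebra_simps)
  have 5: "q ^ (Suc (Suc j) * Suc n + triangular (Suc j)) = u * v * w"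
    unfolding u_def v_def w_def power_add[symmetric] triangular_Suc mult_Suc
    by (simp only: add_Suc_right add_ac Suc_eq_plus1)
  have "(\<Sum>s\<le>Suc j. shanks_term q (Suc n) s - shanks_term q n s) =
    (-1) ^ Suc j * ((1 - v) * R) * u +
    ((-1) ^ Suc j * ((1 - w) * R) * (u * v) - (-1) ^ Suc j * R * u)"
    using Suc.IH Suc.prems
    unfolding sum.atMost_Suc shanks_term_def[of q _ "Suc j"] 1 2 3 4 R_def[symmetric] u_def[symmetric]
    by simp
  also have "\<dots> = (-1) ^ Suc (Suc j) * R * (u * v * w)"
    by (simp add: algebra_simps)
  finally show ?case
    unfolding 5 R_def .
qed

text \<open>Shanks' finite form of the pentagonal number theorem. The inner sum ranges over a set, so
  for \<^term>\<open>s = 0\<close> the two coinciding exponents contribute only once.\<close>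

lemma shanks_identity:
  fixes q :: "'a::comm_ring_1"
  shows "(\<Sum>s\<le>n. shanks_term q n s) =
    (\<Sum>s\<le>n. (-1) ^ s * (\<Sum>e\<in>{s * (3 * s + 1) div 2, s * (3 * s - 1) div 2}. q ^ e))"
proof (induction n)
  case 0
  show ?case by (simp add: shanks_term_def)
next
  case (Suc n)
  let ?N = "Suc n"
  \<comment> \<open>Both new exponents come from N^2 + N (N \<plusminus> 1) / 2 = N (3 N
    \<plusminus> 1) / 2, where \<open>triangular n\<close> is the case of the minus sign.\<close>
  have "?N * (3 * ?N + 1) = ?N * (?N + 1) + (?N * ?N) * 2"
    by (simp add: algebra_simps)
  then have e1: "?N * ?N + triangular ?N = ?N * (3 * ?N + 1) div 2"
    unfolding triangular_def by presburger
  have "?N * (3 * ?N - 1) = n * (n + 1) + (?N * ?N) * 2"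
    by (simp add: algebra_simps)
  then have e2: "?N * ?N + triangular n = ?N * (3 * ?N - 1) div 2"
    unfolding triangular_def by presburger
  have ne: "?N * (3 * ?N + 1) div 2 \<noteq> ?N * (3 * ?N - 1) div 2"
    by (simp only: e1[symmetric] e2[symmetric] triangular_Suc)
  \<comment> \<open>The telescoped change contributes the smaller pentagonal exponent, the new
    summand s = N the larger one. As they differ, both survive in the sum over a set.\<close>
  have "(\<Sum>s\<le>?N. shanks_term q ?N s) =
      (\<Sum>s\<le>n. shanks_term q n s) + (\<Sum>s\<le>n. shanks_term q ?N s - shanks_term q n s) +
      shanks_term q ?N ?N"
    by (simp add: sum_subtractf)
  also have "(\<Sum>s\<le>n. shanks_term q ?N s - shanks_term q n s) =
      (-1) ^ ?N * q ^ (?N * (3 * ?N - 1) div 2)"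
    unfolding shanks_telescope[OF order_refl] e2 by simp
  also have "shanks_term q ?N ?N = (-1) ^ ?N * q ^ (?N * (3 * ?N + 1) div 2)"
    unfolding shanks_term_def e1 by simp
  finally show ?case
    using ne unfolding Suc.IH by (simp add: algebra_simps)
qed

text \<open>These bounds confine the indices k belonging to a given pentagonal value m to k \<le> m,
  which makes the index sets finite.\<close>

lemma pentagonal_ge:
  fixes k :: nat
  shows "k \<le> k * (3 * k - 1) div 2" "k \<le> k * (3 * k + 1) div 2"
proof -
  have "k * 2 \<le> k * (3 * k - 1)"
    by (cases k) auto
  then show "k \<le> k * (3 * k - 1) div 2" by linarith
  have "k * 2 \<le> k * (3 * k + 1)"
    by (cases k) auto
  then show "k \<le> k * (3 * k + 1) div 2" by linarith
qed

lemma fps_nth_pentagonal_term: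
  "fps_nth ((-1) ^ s * (\<Sum>e\<in>A. fps_X ^ e) :: rat fps) m = (if finite A \<and> m \<in> A then (-1) ^ s else 0)"
proof -
  have "(-1) ^ s = (fps_const ((-1) ^ s) :: rat fps)"
    by (simp flip: fps_const_power fps_const_neg)
  then show ?thesis
    by (cases "finite A") (simp_all add: fps_sum_nth if_distrib sum.delta cong: if_cong)
qed

text \<open>Take q = X and n = m in Shanks' identity. For 0 < s \<le> m the exponent s m +
  \<open>triangular s\<close> exceeds m, so only the term s = 0, a partial Euler product, reaches
  coefficient m.\<close>

lemma pentagonal_number_theorem:
  "fps_nth euler_product m =
    (\<Sum>k | k * (3 * k + 1) div 2 = m \<or> k * (3 * k - 1) div 2 = m. (-1) ^ k)"
proof -
  have vanish: "fps_nth (shanks_term fps_X m s :: rat fps) m = 0" if "0 < s" "s \<le> m" for s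
  proof -
    have "1 * m \<le> s * m" "0 < triangular s"
      using that by (auto simp: triangular_Suc gr0_conv_Suc)
    then have "m < s * m + triangular s" by linarith
    then show ?thesis
      by (simp add: shanks_term_def fps_X_power_mult_right_nth)
  qed
  have "fps_nth euler_product m = fps_nth (shanks_term fps_X m 0) m"
    by (simp add: euler_product_nth[of m m] euler_partial_def shanks_term_def
        atLeastSucAtMost_greaterThanAtMost)
  also have "\<dots> = (\<Sum>s\<le>m. fps_nth (shanks_term fps_X m s) m)"
    using vanish by (subst sum.remove[of _ 0]) (auto intro!: sum.neutral)
  also have "\<dots> = fps_nth (\<Sum>s\<le>m. (-1) ^ s *
      (\<Sum>e\<in>{s * (3 * s + 1) div 2, s * (3 * s - 1) div 2}. fps_X ^ e)) m"
    by (simp only: shanks_identity[symmetric] fps_sum_nth)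
  also have "\<dots> = (\<Sum>s\<le>m. if s * (3 * s + 1) div 2 = m \<or> s * (3 * s - 1) div 2 = m
      then (-1) ^ s else 0)"
    unfolding fps_sum_nth fps_nth_pentagonal_term by (intro sum.cong) auto
  also have "\<dots> = (\<Sum>k | k \<in> {..m} \<and> (k * (3 * k + 1) div 2 = m \<or> k * (3 * k - 1) div 2 = m). (-1) ^ k)"
    by (simp only: sum.inter_filter[symmetric] finite_atMost)
  also have "{k. k \<in> {..m} \<and> (k * (3 * k + 1) div 2 = m \<or> k * (3 * k - 1) div 2 = m)} =
      {k. k * (3 * k + 1) div 2 = m \<or> k * (3 * k - 1) div 2 = m}"
    using pentagonal_ge by auto
  finally show ?thesis .
qed

section \<open>Entries as coefficients\<close>

definition geom :: "nat \<Rightarrow> rat fps" where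
  "geom i = fps_X ^ i / (1 - fps_X ^ i)"

lemma geom_mult: "0 < i \<Longrightarrow> (1 - fps_X ^ i) * geom i = fps_X ^ i"
proof -
  assume "0 < i"
  then have nz: "fps_nth (1 - fps_X ^ i :: rat fps) 0 \<noteq> 0" by simp
  then have "(1 - fps_X ^ i) * geom i = fps_X ^ i * ((1 - fps_X ^ i) * inverse (1 - fps_X ^ i))"
    unfolding geom_def fps_divide_unit[OF nz] by (simp only: mult_ac)
  then show ?thesis
    using inverse_mult_eq_1'[OF nz] by simp
qed

text \<open>Multiplying the indicator series of the positive multiples of i by 1 - X^i telescopes to
  X^i, as it does for \<open>geom i\<close>; the nonzero factor can then be cancelled.\<close>

lemma geom_nth:
  assumes "0 < i"
  shows "fps_nth (geom i) n = (if 0 < n \<and> i dvd n then 1 else 0)"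
proof -
  let ?L = "Abs_fps (\<lambda>n. if 0 < n \<and> i dvd n then 1 else 0) :: rat fps"
  have "(1 - fps_X ^ i) * ?L = fps_X ^ i"
    using assms
    by (auto simp: fps_eq_iff left_diff_distrib fps_X_power_mult_nth dvd_minus_self dest: dvd_imp_le)
  with geom_mult[OF assms] have "(1 - fps_X ^ i) * geom i = (1 - fps_X ^ i) * ?L" by simp
  moreover have "1 - fps_X ^ i \<noteq> (0 :: rat fps)"
  proof
    assume "1 - fps_X ^ i = (0 :: rat fps)"
    then have "fps_nth (1 - fps_X ^ i :: rat fps) 0 = 0" by simp
    with assms show False by simp
  qed
  ultimately have "geom i = ?L" by simp
  then show ?thesis by simp
qed

text \<open>In the Cauchy product \<open>geom i\<close> selects the indices (s + 1) i, and the
  pentagonal number theorem expands the complementary coefficient as a signed sum over k.\<close>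

lemma a_entry_eq_coeff:
  assumes "1 \<le> i" "i \<le> n"
  shows "of_int (a_entry n i) = fps_nth (euler_product * geom i) n"
proof -
  let ?K = "\<lambda>m. {k::nat. k * (3 * k + 1) div 2 = m \<or> k * (3 * k - 1) div 2 = m}"
  \<comment> \<open>The bound keeps \<open>n - (s + 1) * i\<close> a genuine difference. Beyond it,
    truncation would give 0 and admit the spurious index k = 0.\<close>
  let ?S = "{s. (s + 1) * i \<le> n}"
  have "?S \<subseteq> {..n}"
  proof
    fix s assume "s \<in> ?S"
    moreover have "(s + 1) * 1 \<le> (s + 1) * i" using assms by (intro mult_left_mono) auto
    ultimately show "s \<in> {..n}" by auto
  qed
  then have finS: "finite ?S" by (rule finite_subset) simp
  have finK: "finite (?K m)" for m
    by (rule finite_subset[of _ "{..m}"]) (use pentagonal_ge in auto)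
  have "fps_nth (euler_product * geom i) n =
      (\<Sum>j\<in>{0..n}. fps_nth (geom i) j * fps_nth euler_product (n - j))"
    by (subst mult.commute) (rule fps_mult_nth)
  also have "\<dots> = (\<Sum>j\<in>(\<lambda>s. (s + 1) * i) ` ?S. fps_nth euler_product (n - j))"
  proof (rule sum.mono_neutral_cong_right)
    show "\<forall>j\<in>{0..n} - (\<lambda>s. (s + 1) * i) ` ?S. fps_nth (geom i) j * fps_nth euler_product (n - j) = 0"
    proof
      fix j assume j: "j \<in> {0..n} - (\<lambda>s. (s + 1) * i) ` ?S"
      have "\<not> (0 < j \<and> i dvd j)"
      proof
        assume "0 < j \<and> i dvd j"
        then obtain t where "j = Suc t * i" by (metis dvd_def mult.commute mult_0 nat_neq_iff not0_implies_Suc)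
        with j show False by auto
      qed
      then show "fps_nth (geom i) j * fps_nth euler_product (n - j) = 0"
        using assms by (auto simp: geom_nth)
    qed
  qed (use assms in \<open>auto simp: geom_nth\<close>)
  also have "\<dots> = (\<Sum>s\<in>?S. \<Sum>k\<in>?K (n - (s + 1) * i). (-1) ^ k)"
    using assms by (subst sum.reindex) (auto simp: inj_on_def pentagonal_number_theorem)
  also have "\<dots> = (\<Sum>(s, k)\<in>Sigma ?S (\<lambda>s. ?K (n - (s + 1) * i)). (-1) ^ k)"
    using finS finK by (subst sum.Sigma) auto
  also have "\<dots> = (\<Sum>(k, s)\<in>{(k, s). (s + 1) * i + (k * (3 * k + 1)) div 2 = n \<or>
          (s + 1) * i + (k * (3 * k - 1)) div 2 = n}. (-1) ^ k)"
    by (rule sum.reindex_bij_witness[of _ prod.swap prod.swap]) auto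
  also have "\<dots> = of_int (a_entry n i)"
    using assms by (simp add: a_entry_def case_prod_unfold)
  finally show ?thesis by simp
qed

section \<open>Signed counts of partitions into distinct parts\<close>

text \<open>A multiset with multiplicities at most 1 is determined by its support. This moves sums
  over partitions to subsets of {1..n}, the form in which the product expands.\<close>

lemma bij_betw_distinct_partitions:
  "bij_betw mset_set {S \<in> Pow {1..n}. \<Sum>S = n} (distinct_partitions n)"
proof (rule bij_betwI[where g = set_mset])
  show "mset_set \<in> {S \<in> Pow {1..n}. \<Sum>S = n} \<rightarrow> distinct_partitions n"
  proof
    fix S assume S: "S \<in> {S \<in> Pow {1..n}. \<Sum>S = n}"
    then have "finite S" using finite_subset by auto
    with S show "mset_set S \<in> distinct_partitions n"
      by (auto simp: distinct_partitions_def count_mset_set' sum_unfold_sum_mset)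
  qed
  have mset: "mset_set (set_mset P) = P" if "P \<in> distinct_partitions n" for P
  proof (rule multiset_eqI)
    fix x
    have "count P x \<le> 1" using that by (auto simp: distinct_partitions_def)
    then show "count (mset_set (set_mset P)) x = count P x"
      by (cases "count P x") (auto simp: count_mset_set' simp flip: count_greater_zero_iff)
  qed
  show "set_mset \<in> distinct_partitions n \<rightarrow> {S \<in> Pow {1..n}. \<Sum>S = n}"
  proof
    fix P assume P: "P \<in> distinct_partitions n"
    have "\<Sum>(set_mset P) = n"
      using P by (simp add: sum_unfold_sum_mset mset) (simp add: distinct_partitions_def)
    moreover have "x \<in> {1..n}" if "x \<in># P" for x
      using P that sum_mset.remove[OF that] by (auto simp: distinct_partitions_def Suc_le_eq intro: gr0I)
    ultimately show "set_mset P \<in> {S \<in> Pow {1..n}. \<Sum>S = n}" by auto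
  qed
  show "set_mset (mset_set S) = S" if "S \<in> {S \<in> Pow {1..n}. \<Sum>S = n}" for S
    using that finite_subset[of S "{1..n}"] by auto
  show "mset_set (set_mset P) = P" if "P \<in> distinct_partitions n" for P
    using that by (rule mset)
qed

text \<open>The multiplicity of k is 1 or 0, so only sets containing k count. Removing k lowers the
  cardinality by one, which absorbs the minus sign in front of (-1)^card.\<close>

lemma s_o_minus_s_e:
  assumes "1 \<le> k" "k \<le> n"
  shows "int (s_o n k) - int (s_e n k) =
    (\<Sum>T | T \<subseteq> {1..n} - {k} \<and> \<Sum>T + k = n. (-1) ^ card T)"
proof -
  let ?D = "distinct_partitions n" and ?S = "{S \<in> Pow {1..n}. \<Sum>S = n}"
  have finD: "finite ?D"
    using bij_betw_finite[OF bij_betw_distinct_partitions, of n] by simp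
  have "int (s_o n k) - int (s_e n k) =
      (\<Sum>P\<in>?D. if odd (size P) then int (count P k) else 0) -
      (\<Sum>P\<in>?D. if even (size P) then int (count P k) else 0)"
    unfolding s_o_def s_e_def by (simp only: of_nat_sum sum.inter_filter[OF finD] if_distrib[of int] of_nat_0)
  also have "\<dots> = (\<Sum>P\<in>?D. - ((-1) ^ size P * int (count P k)))"
    unfolding sum_subtractf[symmetric] by (intro sum.cong) auto
  also have "\<dots> = (\<Sum>S\<in>?S. - ((-1) ^ size (mset_set S) * int (count (mset_set S) k)))"
    by (rule sum.reindex_bij_betw[OF bij_betw_distinct_partitions, symmetric])
  also have "\<dots> = (\<Sum>S\<in>{S \<in> ?S. k \<in> S}. - ((-1) ^ card S))"
    by (rule sum.mono_neutral_cong_right) (auto simp: count_mset_set' dest: finite_subset)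
  also have "\<dots> = (\<Sum>T | T \<subseteq> {1..n} - {k} \<and> \<Sum>T + k = n. (-1) ^ card T)"
  proof (rule sum.reindex_bij_witness[of _ "insert k" "\<lambda>S. S - {k}"])
    fix S assume S: "S \<in> {S \<in> ?S. k \<in> S}"
    then have fin: "finite S" using finite_subset by auto
    then show "S - {k} \<in> {T. T \<subseteq> {1..n} - {k} \<and> \<Sum>T + k = n}"
      using S sum.remove[of S k id] by auto
    show "(-1) ^ card (S - {k}) = (- ((-1) ^ card S) :: int)"
    proof -
      have "card S = Suc (card (S - {k}))"
        using S card.remove[OF fin, of k] by auto
      then show ?thesis by (simp only: power_Suc)
    qed
  next
    fix T assume T: "T \<in> {T. T \<subseteq> {1..n} - {k} \<and> \<Sum>T + k = n}"
    then have "finite T" using finite_subset by blast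
    moreover have "k \<notin> T" using T by auto
    ultimately show "insert k T \<in> {S \<in> ?S. k \<in> S}"
      using T assms by auto
  qed auto
  finally show ?thesis .
qed

text \<open>Coefficient n sees only the first n Euler factors. The factor m = k cancels the
  denominator of \<open>geom k\<close>, and expanding the others over subsets T yields the signed
  sum for s_o - s_e.\<close>

lemma s_o_minus_s_e_eq_coeff:
  assumes "1 \<le> k" "k \<le> n"
  shows "of_int (int (s_o n k) - int (s_e n k)) = fps_nth (euler_product * geom k) n"
proof -
  let ?A = "{1..n} - {k}"
  have sgn: "(-1) ^ c = (fps_const ((-1) ^ c) :: rat fps)" for c :: nat
    by (simp flip: fps_const_power fps_const_neg)
  have "fps_nth (euler_product * geom k) n = fps_nth (euler_partial n * geom k) n"
    unfolding fps_mult_nth by (intro sum.cong) (auto simp: euler_product_nth)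
  also have "euler_partial n = (1 - fps_X ^ k) * (\<Prod>m\<in>?A. 1 - fps_X ^ m)"
    unfolding euler_partial_def using assms by (intro prod.remove) auto
  also have "\<dots> * geom k = fps_X ^ k * (\<Prod>m\<in>?A. 1 - fps_X ^ m)"
    using geom_mult[of k] assms by (simp add: mult_ac)
  also have "(\<Prod>m\<in>?A. 1 - fps_X ^ m :: rat fps) = (\<Sum>T\<in>Pow ?A. fps_const ((-1) ^ card T) * fps_X ^ \<Sum>T)"
    by (simp add: prod_diff_conv_sum power_sum sgn)
  \<comment> \<open>Since k \<le> n, a subset sum equal to the truncated \<open>n - k\<close> is the
    same as one that gives n after adding k.\<close>
  also have "fps_nth (fps_X ^ k * \<dots>) n = (\<Sum>T\<in>Pow ?A. if \<Sum>T + k = n then (-1) ^ card T else 0)"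
    unfolding fps_X_power_mult_nth fps_sum_nth using assms
    by (auto intro!: sum.cong)
  also have "\<dots> = (\<Sum>T | T \<in> Pow ?A \<and> \<Sum>T + k = n. (-1) ^ card T)"
    by (rule sum.inter_filter[symmetric]) simp
  finally show ?thesis
    unfolding s_o_minus_s_e[OF assms] by simp
qed

section \<open>Moebius inversion\<close>

text \<open>The squarefree divisors of n are the products of subsets of its prime factors, so the
  sum is an alternating sum over all these subsets. It vanishes unless n has no prime
  factor.\<close>

lemma sum_moebius_mu:
  assumes "0 < n"
  shows "(\<Sum>d | d dvd n. moebius_mu d) = (if n = 1 then 1 else 0)"
proof -
  let ?P = "prime_factors n"
  have pf: "prime_factors (\<Prod>S) = S" if "S \<subseteq> ?P" for S
  proof -
    have "finite S" using that finite_subset by auto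
    moreover have "0 \<notin> S" "\<forall>p\<in>S. prime p" using that by (auto dest: in_prime_factors_imp_prime)
    ultimately show ?thesis
      by (subst prime_factors_prod) (auto simp: prime_prime_factors)
  qed
  have sqf: "squarefree (\<Prod>S)" if "S \<subseteq> ?P" for S
  proof (rule squarefree_prod_coprime)
    have "prime p" if "p \<in> S" for p
      using that \<open>S \<subseteq> ?P\<close> by (auto dest: in_prime_factors_imp_prime)
    then show "squarefree p" "\<And>q. q \<in> S \<Longrightarrow> p \<noteq> q \<Longrightarrow> coprime p q" if "p \<in> S" for p
      using that by (auto intro: primes_coprime squarefree_prime)
  qed
  have rad: "\<Prod>(prime_factors d) = d" if "squarefree d" "d dvd n" for d
  proof -
    have "d \<noteq> 0" using that assms by auto
    then have "\<Prod>(prime_factors d) = (\<Prod>p\<in>prime_factors d. p ^ multiplicity p d)"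
    proof (intro prod.cong refl)
      fix p assume "p \<in> prime_factors d"
      then have "prime p" "0 < multiplicity p d" by (auto simp: prime_factors_multiplicity)
      moreover have "multiplicity p d \<le> 1"
        using that(1) \<open>prime p\<close> \<open>d \<noteq> 0\<close> by (simp add: squarefree_factorial_semiring'')
      ultimately show "p = p ^ multiplicity p d" by (simp add: le_Suc_eq)
    qed
    also have "\<dots> = d"
      using \<open>d \<noteq> 0\<close> by (simp add: prod_prime_factors)
    finally show ?thesis .
  qed
  have "(\<Sum>d | d dvd n. moebius_mu d) = (\<Sum>d | d dvd n \<and> squarefree d. (-1) ^ card (prime_factors d))"
    using assms by (intro sum.mono_neutral_cong_right) (auto simp: moebius_mu_def)
  also have "\<dots> = (\<Sum>S\<in>Pow ?P. (-1) ^ card S)"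
  proof (rule sum.reindex_bij_witness[of _ "\<lambda>S. \<Prod>S" prime_factors])
    fix S assume S: "S \<in> Pow ?P"
    have "\<Prod>S dvd \<Prod>?P"
      using S by (intro prod_dvd_prod_subset) auto
    also have "\<Prod>?P dvd (\<Prod>p\<in>?P. p ^ multiplicity p n)"
      by (intro prod_dvd_prod) (auto simp: prime_factors_multiplicity)
    also have "\<dots> = n"
      using assms by (simp add: prod_prime_factors)
    finally show "\<Prod>S \<in> {d. d dvd n \<and> squarefree d}"
      using sqf S by auto
  qed (use assms pf rad in \<open>auto simp: dvd_prime_factors\<close>)
  also have "\<dots> = (if ?P = {} then 1 else 0)"
  proof (cases "?P = {}")
    case False
    \<comment> \<open>With lower set \<open>{}\<close>, \<open>card_subsupersets_even_odd\<close>
      says that a nonempty finite set has as many even as odd subsets.\<close>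
    then have "{} \<subset> ?P" by auto
    then have "(\<Sum>S\<in>Pow ?P. (-1) ^ card S :: int) = 0"
      using card_subsupersets_even_odd[of ?P "{}"] by (intro sum_alternating_cancels) auto
    with False show ?thesis by simp
  qed simp
  also have "?P = {} \<longleftrightarrow> n = 1"
    using assms by (auto simp: prime_factorization_empty_iff)
  finally show ?thesis .
qed

text \<open>If n = i m, then d \<mapsto> n / d sends the divisors of n that are multiples of i
  bijectively to the divisors of m. If i does not divide n, there are no such d.\<close>

lemma sum_moebius_mu_multiples:
  assumes "0 < n" "0 < i"
  shows "(\<Sum>d | d dvd n. if i dvd d then moebius_mu (n div d) else 0) = (if n = i then 1 else 0)"
proof (cases "i dvd n")
  case True
  then obtain m where m: "n = i * m" by auto
  then have "0 < m" using assms by auto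
  have "(\<Sum>d | d dvd n. if i dvd d then moebius_mu (n div d) else 0) =
      (\<Sum>d | d \<in> {d. d dvd n} \<and> i dvd d. moebius_mu (n div d))"
    using assms by (subst sum.inter_filter) auto
  also have "\<dots> = (\<Sum>e | e dvd m. moebius_mu e)"
  proof (rule sum.reindex_bij_witness[of _ "\<lambda>e. n div e" "\<lambda>d. n div d"])
    fix e assume "e \<in> {e. e dvd m}"
    then obtain c where "m = e * c" by auto
    then show "n div (n div e) = e" "n div e \<in> {d. d \<in> {d. d dvd n} \<and> i dvd d}"
      using \<open>0 < m\<close> assms m by (auto simp: mult_ac)
  next
    fix d assume "d \<in> {d. d \<in> {d. d dvd n} \<and> i dvd d}"
    then obtain b c where "n = i * b * c" "d = i * b" by (auto elim!: dvdE)
    then show "n div (n div d) = d" "n div d \<in> {e. e dvd m}" "moebius_mu (n div d) = moebius_mu (n div d)"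
      using assms m by (auto simp: mult_ac)
  qed
  also have "\<dots> = (if n = i then 1 else 0)"
    using sum_moebius_mu[OF \<open>0 < m\<close>] m assms by auto
  finally show ?thesis .
next
  case False
  then show ?thesis
    by (auto intro!: sum.neutral dest: dvd_trans)
qed

section \<open>The inverse matrix\<close>

definition A_inv_entry :: "nat \<Rightarrow> nat \<Rightarrow> rat" where
  "A_inv_entry n i = (\<Sum>d | d dvd n. partition_p (int d - int i) * of_int (moebius_mu (n div d)))"

lemma sum_partition_p_a_entry:
  assumes "0 < i" "0 < d" "d \<le> N"
  shows "(\<Sum>j\<in>{1..N}. partition_p (int d - int j) * of_int (a_entry j i)) = (if i dvd d then 1 else 0)"
proof -
  \<comment> \<open>The coefficient formula extends to j < i: \<open>a_entry\<close> is 0 there by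
    convention, and \<open>geom i\<close> starts at X^i.\<close>
  have a: "of_int (a_entry j i) = fps_nth (euler_product * geom i) j" for j
  proof (cases "i \<le> j")
    case False
    then have "fps_nth (geom i) (j - x) = 0" for x
      using assms dvd_imp_le[of i "j - x"] by (auto simp: geom_nth)
    then have "fps_nth (euler_product * geom i) j = 0"
      by (simp add: fps_mult_nth)
    then show ?thesis using False by (simp add: a_entry_def)
  qed (use assms a_entry_eq_coeff in simp)
  \<comment> \<open>The ranges may be exchanged: \<open>partition_p\<close> vanishes for j > d, and
    the coefficient at j = 0 is 0 because \<open>geom i\<close> has no constant term.\<close>
  have "(\<Sum>j\<in>{1..N}. partition_p (int d - int j) * of_int (a_entry j i)) =
      (\<Sum>j\<in>{0..d}. fps_nth (euler_product * geom i) j * fps_nth (inverse euler_product) (d - j))"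
  proof (rule sum.mono_neutral_cong)
    show "fps_nth (euler_product * geom i) j * fps_nth (inverse euler_product) (d - j) = 0"
      if "j \<in> {0..d} - {1..N}" for j
    proof -
      have "j = 0" using that assms by auto
      then show ?thesis using assms by (simp add: geom_nth)
    qed
    show "partition_p (int d - int j) * of_int (a_entry j i) =
        fps_nth (euler_product * geom i) j * fps_nth (inverse euler_product) (d - j)"
      if "j \<in> {1..N} \<inter> {0..d}" for j
      using that by (simp add: a partition_p_def nat_diff_distrib)
  qed (use assms in \<open>auto simp: partition_p_def\<close>)
  also have "\<dots> = fps_nth (geom i * (euler_product * inverse euler_product)) d"
    by (simp only: fps_mult_nth[symmetric]) (simp only: mult_ac)
  also have "euler_product * inverse euler_product = 1"
    by (rule inverse_mult_eq_1') (simp add: euler_product_nth_0)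
  finally show ?thesis
    using assms by (simp add: geom_nth)
qed

text \<open>Exchanging the sums isolates the convolution for each divisor d of n. Since d \<le> n
  \<le> N, the range {1..N} covers that convolution completely.\<close>

lemma A_inv_entry_mult:
  assumes "0 < n" "n \<le> N" "0 < i"
  shows "(\<Sum>j\<in>{1..N}. A_inv_entry n j * of_int (a_entry j i)) = (if n = i then 1 else 0)"
proof -
  have "(\<Sum>j\<in>{1..N}. A_inv_entry n j * of_int (a_entry j i)) =
      (\<Sum>d | d dvd n. of_int (moebius_mu (n div d)) *
        (\<Sum>j\<in>{1..N}. partition_p (int d - int j) * of_int (a_entry j i)))"
    unfolding A_inv_entry_def sum_distrib_right sum_distrib_left
    by (rule trans[OF sum.swap]) (intro sum.cong refl, simp only: mult_ac)
  also have "\<dots> = (\<Sum>d | d dvd n. of_int (if i dvd d then moebius_mu (n div d) else 0))"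
  proof (intro sum.cong refl)
    fix d assume "d \<in> {d. d dvd n}"
    then have "0 < d" "d \<le> N"
      using assms dvd_imp_le[of d n] dvd_pos_nat[of n d] by auto
    then show "of_int (moebius_mu (n div d)) *
        (\<Sum>j\<in>{1..N}. partition_p (int d - int j) * of_int (a_entry j i)) =
        of_int (if i dvd d then moebius_mu (n div d) else 0)"
      using assms by (simp only: sum_partition_p_a_entry) simp
  qed
  also have "\<dots> = (if n = i then 1 else 0)"
    using assms by (simp only: of_int_sum[symmetric] sum_moebius_mu_multiples) simp
  finally show ?thesis .
qed

definition A_inv_mat :: "nat \<Rightarrow> rat mat" where
  "A_inv_mat N = mat N N (\<lambda>(r, c). A_inv_entry (r + 1) (c + 1))"

lemma A_mat_carrier: "A_mat N \<in> carrier_mat N N"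
  and A_inv_mat_carrier: "A_inv_mat N \<in> carrier_mat N N"
  by (simp_all add: A_mat_def A_inv_mat_def)

lemma A_inv_mat_mult: "A_inv_mat N * A_mat N = 1\<^sub>m N"
proof (rule eq_matI)
  fix r c assume "r < dim_row (1\<^sub>m N :: rat mat)" "c < dim_col (1\<^sub>m N :: rat mat)"
  then have rc: "r < N" "c < N" by auto
  then have "(A_inv_mat N * A_mat N) $$ (r, c) =
      (\<Sum>j\<in>{0..<N}. A_inv_entry (r + 1) (j + 1) * of_int (a_entry (j + 1) (c + 1)))"
    by (simp add: A_inv_mat_def A_mat_def scalar_prod_def)
  also have "\<dots> = (\<Sum>j\<in>{1..N}. A_inv_entry (r + 1) j * of_int (a_entry j (c + 1)))"
    by (rule sum.reindex_bij_witness[of _ "\<lambda>j. j - 1" Suc]) auto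
  also have "\<dots> = 1\<^sub>m N $$ (r, c)"
    using rc by (subst A_inv_entry_mult) auto
  finally show "(A_inv_mat N * A_mat N) $$ (r, c) = 1\<^sub>m N $$ (r, c)" .
qed (simp_all add: A_mat_def A_inv_mat_def)

text \<open>Over a field a one-sided inverse of a square matrix is two-sided.\<close>

lemma A_mat_mult: "A_mat N * A_inv_mat N = 1\<^sub>m N"
  by (rule mat_mult_left_right_inverse[OF A_inv_mat_carrier A_mat_carrier A_inv_mat_mult])

lemma invertible_A_mat: "invertible_mat (A_mat N)"
  unfolding invertible_mat_def inverts_mat_def
proof (intro conjI exI)
  show "square_mat (A_mat N)"
    using A_mat_carrier[of N] by simp
  show "A_mat N * A_inv_mat N = 1\<^sub>m (dim_row (A_mat N))"
    using A_mat_carrier[of N] by (simp add: A_mat_mult)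
  show "A_inv_mat N * A_mat N = 1\<^sub>m (dim_row (A_inv_mat N))"
    using A_inv_mat_carrier[of N] by (simp add: A_inv_mat_mult)
qed

text \<open>\<open>inverts_mat\<close> does not fix the shape of B, so its dimensions are read off
  from the column counts of the two products. Then the usual associativity argument for uniqueness
  applies.\<close>

lemma inverse_A_mat_unique:
  assumes "inverts_mat (A_mat N) B" "inverts_mat B (A_mat N)"
  shows "B = A_inv_mat N"
proof -
  have AB: "A_mat N * B = 1\<^sub>m N" and BA: "B * A_mat N = 1\<^sub>m (dim_row B)"
    using assms A_mat_carrier[of N] by (auto simp: inverts_mat_def)
  have "dim_col B = N"
    using arg_cong[OF AB, of dim_col] by simp
  moreover have "dim_row B = N"
    using arg_cong[OF BA, of dim_col] A_mat_carrier[of N] by simp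
  ultimately have B: "B \<in> carrier_mat N N" by auto
  have "B = A_inv_mat N * A_mat N * B"
    using B by (simp add: A_inv_mat_mult)
  also have "\<dots> = A_inv_mat N * (A_mat N * B)"
    by (rule assoc_mult_mat[OF A_inv_mat_carrier A_mat_carrier B])
  also have "\<dots> = A_inv_mat N"
    using A_inv_mat_carrier[of N] by (simp add: AB)
  finally show ?thesis .
qed

theorem theorem2p16:
  shows "(\<forall>n i :: nat. 1 \<le> i \<and> i \<le> n \<longrightarrow>
            a_entry n i = int (s_o n i) - int (s_e n i) \<and>
            of_int (int (s_o n i) - int (s_e n i))
              = fps_nth (euler_product * (fps_X ^ i / (1 - fps_X ^ i))) n)
       \<and> (\<forall>N :: nat. 1 \<le> N \<longrightarrow>
            invertible_mat (A_mat N) \<and>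
            (\<forall>B :: rat mat. inverts_mat (A_mat N) B \<and> inverts_mat B (A_mat N) \<longrightarrow>
               (\<forall>n i :: nat. 1 \<le> i \<and> i \<le> n \<and> n \<le> N \<longrightarrow>
                  B $$ (n - 1, i - 1)
                    = (\<Sum>d | d dvd n. partition_p (int d - int i) * of_int (moebius_mu (n div d))))))"
proof (intro conjI allI impI)
  fix n i :: nat assume ni: "1 \<le> i \<and> i \<le> n"
  show "of_int (int (s_o n i) - int (s_e n i)) =
      fps_nth (euler_product * (fps_X ^ i / (1 - fps_X ^ i))) n"
    using s_o_minus_s_e_eq_coeff ni by (simp only: geom_def)
  \<comment> \<open>The integers are compared as rational coefficients; injectivity of
    \<open>of_int\<close> brings the equality back.\<close>
  have "(of_int (a_entry n i) :: rat) = of_int (int (s_o n i) - int (s_e n i))"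
    using a_entry_eq_coeff s_o_minus_s_e_eq_coeff ni by simp
  then show "a_entry n i = int (s_o n i) - int (s_e n i)"
    by (simp only: of_int_eq_iff)
next
  fix N :: nat
  show "invertible_mat (A_mat N)"
    by (rule invertible_A_mat)
next
  fix N n i :: nat and B :: "rat mat"
  assume "inverts_mat (A_mat N) B \<and> inverts_mat B (A_mat N)" "1 \<le> i \<and> i \<le> n \<and> n \<le> N"
  then have "B $$ (n - 1, i - 1) = A_inv_entry n i"
    using inverse_A_mat_unique[of N B] by (auto simp: A_inv_mat_def)
  then show "B $$ (n - 1, i - 1) =
      (\<Sum>d | d dvd n. partition_p (int d - int i) * of_int (moebius_mu (n div d)))"
    by (simp only: A_inv_entry_def)
qed

end
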